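(* Let $(V_1,V_2,V_3)$ be a $\mathbb P$-isometry on a Hilbert space $\mathcal H$. Then there is a unique orthogonal decomposition $\mathcal H=\mathcal H_u\oplus\mathcal H_c$ into closed subspaces reducing each of $V_1,V_2,V_3$ such that $(V_1|_{\mathcal H_u},V_2|_{\mathcal H_u},V_3|_{\mathcal H_u})$ is a $\mathbb P$-unitary and $(V_1|_{\mathcal H_c},V_2|_{\mathcal H_c},V_3|_{\mathcal H_c})$ is a pure $\mathbb P$-isometry.
   Context: The closed symmetrized bidisc is $\Gamma=\{(z_1+z_2,z_1z_2):z_1,z_2\in\overline{\mathbb D}\}$ and $b\Gamma=\{(z_1+z_2,z_1z_2):|z_1|=|z_2|=1\}$. The pentablock is $\mathbb P=\{(a_{21},\operatorname{tr}A_0,\det A_0): A_0=[a_{ij}]\in M_2(\mathbb C),\ \|A_0\|<1\}$, with distinguished boundary $b\mathbb P=\{(a,s,p):(s,p)\in b\Gamma,\ |a|^2+\frac14|s|^2=1\}$. A $\mathbb P$-unitary is a commuting triple of normal operators whose Taylor joint spectrum lies in $b\mathbb P$. A $\mathbb P$-isometry on $\mathcal H$ is the restriction to $\mathcal H$ of a $\mathbb P$-unitary on some $\mathcal K\supseteq\mathcal H$ having $\mathcal H$ as a joint invariant subspace. A $\mathbb P$-isometry is pure if there is no nonzero closed joint reducing subspace on which it restricts to a $\mathbb P$-unitary. *)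

theory Defs
  imports "HOL-Analysis.Analysis"
begin

class complex_vector = real_vector +
  fixes scaleC :: "complex \<Rightarrow> 'a \<Rightarrow> 'a" (infixr "*\<^sub>C" 75)
  assumes scaleC_add_right: "a *\<^sub>C (x + y) = a *\<^sub>C x + a *\<^sub>C y"
    and scaleC_add_left: "(a + b) *\<^sub>C x = a *\<^sub>C x + b *\<^sub>C x"
    and scaleC_scaleC: "a *\<^sub>C (b *\<^sub>C x) = (a * b) *\<^sub>C x"
    and scaleC_one: "1 *\<^sub>C x = x"
    and scaleR_scaleC: "scaleR r x = of_real r *\<^sub>C x"

class complex_inner = complex_vector + real_normed_vector +
  fixes cinner :: "'a \<Rightarrow> 'a \<Rightarrow> complex"
  assumes cinner_commute: "cinner x y = cnj (cinner y x)"
    and cinner_add_left: "cinner (x + y) z = cinner x z + cinner y z"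
    and cinner_scaleC_left: "cinner (r *\<^sub>C x) y = cnj r * cinner x y"
    and cinner_self_real: "Im (cinner x x) = 0 \<and> 0 \<le> Re (cinner x x)"
    and norm_eq_sqrt_cinner: "norm x = sqrt (Re (cinner x x))"

text \<open>A complex Hilbert space is a type of class complex_inner and complete_space.\<close>

definition csubspace :: "'a::complex_vector set \<Rightarrow> bool" where
  "csubspace S \<longleftrightarrow> 0 \<in> S \<and> (\<forall>x\<in>S. \<forall>y\<in>S. x + y \<in> S) \<and> (\<forall>c. \<forall>x\<in>S. c *\<^sub>C x \<in> S)"

definition closed_csubspace :: "'a::{complex_vector,topological_space} set \<Rightarrow> bool" where
  "closed_csubspace S \<longleftrightarrow> csubspace S \<and> closed S"

definition orth_compl :: "'a::complex_inner set \<Rightarrow> 'a set \<Rightarrow> 'a set" where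
  "orth_compl S M = {x\<in>S. \<forall>y\<in>M. cinner x y = 0}"

definition cbounded_on :: "'a::complex_inner set \<Rightarrow> ('a \<Rightarrow> 'a) \<Rightarrow> bool" where
  "cbounded_on S T \<longleftrightarrow> T ` S \<subseteq> S \<and>
     (\<forall>x\<in>S. \<forall>y\<in>S. T (x + y) = T x + T y) \<and>
     (\<forall>c. \<forall>x\<in>S. T (c *\<^sub>C x) = c *\<^sub>C T x) \<and>
     (\<exists>C. \<forall>x\<in>S. norm (T x) \<le> C * norm x)"

definition adjoint_on :: "'a::complex_inner set \<Rightarrow> ('a \<Rightarrow> 'a) \<Rightarrow> ('a \<Rightarrow> 'a) \<Rightarrow> bool" where
  "adjoint_on S T T' \<longleftrightarrow> cbounded_on S T' \<and> (\<forall>x\<in>S. \<forall>y\<in>S. cinner (T x) y = cinner x (T' y))"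

definition normal_on :: "'a::complex_inner set \<Rightarrow> ('a \<Rightarrow> 'a) \<Rightarrow> bool" where
  "normal_on S T \<longleftrightarrow> cbounded_on S T \<and>
     (\<exists>T'. adjoint_on S T T' \<and> (\<forall>x\<in>S. T (T' x) = T' (T x)))"

definition commute_on :: "'a set \<Rightarrow> ('a \<Rightarrow> 'a) \<Rightarrow> ('a \<Rightarrow> 'a) \<Rightarrow> bool" where
  "commute_on S T U \<longleftrightarrow> (\<forall>x\<in>S. T (U x) = U (T x))"

definition reducing_on :: "'a::complex_inner set \<Rightarrow> 'a set \<Rightarrow> ('a \<Rightarrow> 'a) \<Rightarrow> bool" where
  "reducing_on S M T \<longleftrightarrow> closed_csubspace M \<and> M \<subseteq> S \<and> T ` M \<subseteq> M \<and>
     T ` (orth_compl S M) \<subseteq> orth_compl S M"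

text \<open>Exactness of the Koszul complex
  0 \<rightarrow> S \<rightarrow> S^3 \<rightarrow> S^3 \<rightarrow> S \<rightarrow> 0 of the commuting triple (A,B,C) on S,
  with d0 x = (Ax,Bx,Cx), d1(x1,x2,x3) = (Ax2-Bx1, Ax3-Cx1, Bx3-Cx2)
  (coordinates e1^e2, e1^e3, e2^e3) and d2(y12,y13,y23) = Ay23 - By13 + Cy12.\<close>
definition koszul_exact :: "'a::complex_inner set \<Rightarrow> ('a \<Rightarrow> 'a) \<Rightarrow> ('a \<Rightarrow> 'a) \<Rightarrow> ('a \<Rightarrow> 'a) \<Rightarrow> bool" where
  "koszul_exact S A B C \<longleftrightarrow>
     (\<forall>x\<in>S. A x = 0 \<and> B x = 0 \<and> C x = 0 \<longrightarrow> x = 0) \<and>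
     (\<forall>x1\<in>S. \<forall>x2\<in>S. \<forall>x3\<in>S.
        A x2 - B x1 = 0 \<and> A x3 - C x1 = 0 \<and> B x3 - C x2 = 0 \<longrightarrow>
        (\<exists>x\<in>S. x1 = A x \<and> x2 = B x \<and> x3 = C x)) \<and>
     (\<forall>y12\<in>S. \<forall>y13\<in>S. \<forall>y23\<in>S.
        A y23 - B y13 + C y12 = 0 \<longrightarrow>
        (\<exists>x1\<in>S. \<exists>x2\<in>S. \<exists>x3\<in>S. y12 = A x2 - B x1 \<and> y13 = A x3 - C x1 \<and> y23 = B x3 - C x2)) \<and>
     (\<forall>z\<in>S. \<exists>y12\<in>S. \<exists>y13\<in>S. \<exists>y23\<in>S. z = A y23 - B y13 + C y12)"

definition taylor_spectrum ::
  "'a::complex_inner set \<Rightarrow> ('a \<Rightarrow> 'a) \<Rightarrow> ('a \<Rightarrow> 'a) \<Rightarrow> ('a \<Rightarrow> 'a) \<Rightarrow> (complex \<times> complex \<times> complex) set" where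
  "taylor_spectrum S T1 T2 T3 =
     {(l1, l2, l3). \<not> koszul_exact S (\<lambda>x. T1 x - l1 *\<^sub>C x) (\<lambda>x. T2 x - l2 *\<^sub>C x) (\<lambda>x. T3 x - l3 *\<^sub>C x)}"

definition bGamma :: "(complex \<times> complex) set" where
  "bGamma = {(z1 + z2, z1 * z2) | z1 z2. cmod z1 = 1 \<and> cmod z2 = 1}"

definition bPenta :: "(complex \<times> complex \<times> complex) set" where
  "bPenta = {(a, s, p). (s, p) \<in> bGamma \<and> (cmod a)\<^sup>2 + (cmod s)\<^sup>2 / 4 = 1}"

definition P_unitary_on :: "'a::complex_inner set \<Rightarrow> ('a \<Rightarrow> 'a) \<Rightarrow> ('a \<Rightarrow> 'a) \<Rightarrow> ('a \<Rightarrow> 'a) \<Rightarrow> bool" where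
  "P_unitary_on S V1 V2 V3 \<longleftrightarrow> closed_csubspace S \<and>
     normal_on S V1 \<and> normal_on S V2 \<and> normal_on S V3 \<and>
     commute_on S V1 V2 \<and> commute_on S V1 V3 \<and> commute_on S V2 V3 \<and>
     taylor_spectrum S V1 V2 V3 \<subseteq> bPenta"

text \<open>(V1,V2,V3) restricted to the closed subspace S is a P-isometry: S is identified
  (via a complex-linear isometry J) with a joint invariant subspace of a closed subspace K
  of a Hilbert space of type 'k, on which a P-unitary (U1,U2,U3) extends it.\<close>
definition P_isometry_on ::
  "'k::{complex_inner,complete_space} itself \<Rightarrow> 'a::complex_inner set \<Rightarrow>
   ('a \<Rightarrow> 'a) \<Rightarrow> ('a \<Rightarrow> 'a) \<Rightarrow> ('a \<Rightarrow> 'a) \<Rightarrow> bool" where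
  "P_isometry_on (_::'k itself) S V1 V2 V3 \<longleftrightarrow> closed_csubspace S \<and>
     V1 ` S \<subseteq> S \<and> V2 ` S \<subseteq> S \<and> V3 ` S \<subseteq> S \<and>
     (\<exists>(J::'a \<Rightarrow> 'k) K U1 U2 U3.
        (\<forall>x\<in>S. \<forall>y\<in>S. J (x + y) = J x + J y) \<and>
        (\<forall>c. \<forall>x\<in>S. J (c *\<^sub>C x) = c *\<^sub>C J x) \<and>
        (\<forall>x\<in>S. \<forall>y\<in>S. cinner (J x) (J y) = cinner x y) \<and>
        J ` S \<subseteq> K \<and> P_unitary_on K U1 U2 U3 \<and>
        (\<forall>x\<in>S. U1 (J x) = J (V1 x) \<and> U2 (J x) = J (V2 x) \<and> U3 (J x) = J (V3 x)))"

definition pure_P_isometry_on ::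
  "'k::{complex_inner,complete_space} itself \<Rightarrow> 'a::complex_inner set \<Rightarrow>
   ('a \<Rightarrow> 'a) \<Rightarrow> ('a \<Rightarrow> 'a) \<Rightarrow> ('a \<Rightarrow> 'a) \<Rightarrow> bool" where
  "pure_P_isometry_on k S V1 V2 V3 \<longleftrightarrow> P_isometry_on k S V1 V2 V3 \<and>
     \<not> (\<exists>M. M \<noteq> {0} \<and> reducing_on S M V1 \<and> reducing_on S M V2 \<and> reducing_on S M V3 \<and>
            P_unitary_on M V1 V2 V3)"

end

theory Submission
  imports Defs
begin

text \<open>Let \<open>J\<close> embed \<open>H\<close> isometrically into the space of a \<open>P\<close>-unitary \<open>(U\<^sub>1, U\<^sub>2, U\<^sub>3)\<close> extending
  \<open>(V\<^sub>1, V\<^sub>2, V\<^sub>3)\<close>. If the \<open>V\<^sub>i\<close> are normal on a closed invariant subspace \<open>M\<close>, then \<open>J M\<close> reduces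
  every \<open>U\<^sub>i\<close>, so the Koszul complex of the \<open>V\<^sub>i\<close> on \<open>M\<close> is a direct summand of that of the \<open>U\<^sub>i\<close> and
  the Taylor spectrum can only shrink. Hence on closed invariant subspaces ``\<open>P\<close>-unitary'' just means
  ``normal'', and no spectral theorem is needed. The unitary part is therefore the largest joint
  reducing subspace on which all \<open>V\<^sub>i\<close> are normal, i.e. the set of \<open>x\<close> such that every self-commutator
  of a \<open>V\<^sub>i\<close> vanishes on every \<open>w x\<close>, with \<open>w\<close> a word in the \<open>V\<^sub>i\<close> and \<open>V\<^sub>i\<^sup>*\<close>. If \<open>H\<^sub>u' \<oplus> H\<^sub>c'\<close> is another
  decomposition, maximality gives \<open>H\<^sub>u' \<subseteq> H\<^sub>u\<close>, and \<open>H\<^sub>u \<inter> H\<^sub>c'\<close> is zero by purity of \<open>H\<^sub>c'\<close>.\<close>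

section \<open>Complex inner product spaces\<close>

lemma scaleC_zero_left [simp]: "0 *\<^sub>C (x::'a::complex_vector) = 0"
  using scaleC_add_left[of 0 0 x] by simp

lemma scaleC_zero_right [simp]: "c *\<^sub>C (0::'a::complex_vector) = 0"
  using scaleC_add_right[of c 0 0] by simp

lemma scaleC_minus_one: "(-1) *\<^sub>C (x::'a::complex_vector) = - x"
  using scaleC_add_left[of "-1" 1 x] by (simp add: scaleC_one eq_neg_iff_add_eq_0)

lemma cinner_zero_left [simp]: "cinner 0 (y::'a::complex_inner) = 0"
  using cinner_add_left[of 0 0 y] by simp

lemma cinner_zero_right [simp]: "cinner (x::'a::complex_inner) 0 = 0"
  by (subst cinner_commute) simp

lemma cinner_minus_left: "cinner (- x) (y::'a::complex_inner) = - cinner x y"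
  using cinner_scaleC_left[of "-1" x y] by (simp add: scaleC_minus_one)

lemma cinner_diff_left: "cinner (x - y) (z::'a::complex_inner) = cinner x z - cinner y z"
  using cinner_add_left[of x "- y" z] by (simp add: cinner_minus_left)

lemma cinner_add_right: "cinner x (y + z::'a::complex_inner) = cinner x y + cinner x z"
  by (metis cinner_commute cinner_add_left complex_cnj_add)

lemma cinner_diff_right: "cinner x (y - z::'a::complex_inner) = cinner x y - cinner x z"
  by (metis cinner_commute cinner_diff_left complex_cnj_diff)

lemma cinner_scaleC_right: "cinner x (c *\<^sub>C y::'a::complex_inner) = c * cinner x y"
  by (metis cinner_commute cinner_scaleC_left complex_cnj_cnj complex_cnj_mult)

lemma norm_sq_eq_cinner: "(norm (x::'a::complex_inner))\<^sup>2 = Re (cinner x x)"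
  using cinner_self_real[of x] by (simp add: norm_eq_sqrt_cinner)

lemma cinner_self_eq: "cinner (x::'a::complex_inner) x = of_real ((norm x)\<^sup>2)"
  using cinner_self_real[of x] by (simp add: norm_sq_eq_cinner complex_eq_iff)

lemma cinner_self_eq_0_iff: "cinner (x::'a::complex_inner) x = 0 \<longleftrightarrow> x = 0"
  by (simp add: cinner_self_eq)

lemma Re_cinner_commute: "Re (cinner x (y::'a::complex_inner)) = Re (cinner y x)"
  by (subst cinner_commute) simp

lemma norm_add_sq:
  "(norm (x + y::'a::complex_inner))\<^sup>2 = (norm x)\<^sup>2 + 2 * Re (cinner x y) + (norm y)\<^sup>2"
  by (simp add: norm_sq_eq_cinner cinner_add_left cinner_add_right Re_cinner_commute[of y x])

lemma norm_diff_sq: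
  "(norm (x - y::'a::complex_inner))\<^sup>2 = (norm x)\<^sup>2 - 2 * Re (cinner x y) + (norm y)\<^sup>2"
  by (simp add: norm_sq_eq_cinner cinner_diff_left cinner_diff_right Re_cinner_commute[of y x])

lemma norm_scaleC: "norm (c *\<^sub>C (x::'a::complex_inner)) = cmod c * norm x"
proof -
  have "complex_of_real ((norm (c *\<^sub>C x))\<^sup>2) = (c * cnj c) * cinner x x"
    unfolding cinner_self_eq[symmetric] by (simp add: cinner_scaleC_left cinner_scaleC_right)
  also have "\<dots> = of_real ((cmod c * norm x)\<^sup>2)"
    unfolding complex_norm_square[symmetric] cinner_self_eq by (simp add: power_mult_distrib)
  finally have "complex_of_real ((norm (c *\<^sub>C x))\<^sup>2) = of_real ((cmod c * norm x)\<^sup>2)" .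
  then have "(norm (c *\<^sub>C x))\<^sup>2 = (cmod c * norm x)\<^sup>2"
    using of_real_eq_iff by blast
  then show ?thesis by (simp add: power2_eq_iff_nonneg)
qed

text \<open>The triangle inequality belongs to the class \<open>real_normed_vector\<close>, so
  Cauchy-Schwarz for the real part follows by squaring it, the reverse of the usual order.\<close>

lemma Re_cinner_le: "Re (cinner x (y::'a::complex_inner)) \<le> norm x * norm y"
proof -
  have "(norm (x + y))\<^sup>2 \<le> (norm x + norm y)\<^sup>2"
    by (simp add: norm_triangle_ineq power_mono)
  then show ?thesis by (simp add: norm_add_sq power2_sum)
qed

text \<open>Real and imaginary parts are bounded separately, which gives the factor 2; any constant
  serves for continuity of \<open>cinner\<close>.\<close>

lemma cmod_cinner_le: "cmod (cinner x (y::'a::complex_inner)) \<le> 2 * (norm x * norm y)"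
proof -
  have "\<bar>Re (cinner x y)\<bar> \<le> norm x * norm y" for y :: 'a
    using Re_cinner_le[of x y] Re_cinner_le[of "- x" y] by (simp add: cinner_minus_left abs_le_iff)
  \<comment> \<open>Replacing \<open>y\<close> by \<open>\<i> *\<^sub>C y\<close> turns the real
    part into minus the imaginary part.\<close>
  from this[of y] this[of "\<i> *\<^sub>C y"] have "\<bar>Re (cinner x y)\<bar> \<le> norm x * norm y" "\<bar>Im (cinner x y)\<bar> \<le> norm x * norm y"
    by (simp_all add: cinner_scaleC_right norm_scaleC)
  then show ?thesis using cmod_le[of "cinner x y"] by linarith
qed

lemma bounded_linear_cinner_left: "bounded_linear (\<lambda>x. cinner x (y::'a::complex_inner))"
  by (rule bounded_linear_intro[where K = "2 * norm y"])
    (auto simp: cinner_add_left scaleR_scaleC cinner_scaleC_left scaleR_conv_of_real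
      intro: order_trans[OF cmod_cinner_le])

section \<open>Closed complex subspaces and orthogonal complements\<close>

lemma csubspace_diff: "csubspace S \<Longrightarrow> x \<in> S \<Longrightarrow> y \<in> S \<Longrightarrow> x - y \<in> S"
  unfolding csubspace_def by (metis diff_conv_add_uminus scaleC_minus_one)

lemma csubspace_imp_subspace: "csubspace S \<Longrightarrow> subspace S"
  by (auto simp: csubspace_def subspace_def scaleR_scaleC)

lemma closed_csubspace_orth_compl:
  assumes "closed_csubspace S"
  shows "closed_csubspace (orth_compl S M)"
proof -
  have "closed {x. cinner x y = 0}" for y :: 'a
    by (intro closed_Collect_eq continuous_intros linear_continuous_on bounded_linear_cinner_left)
  then have "closed (S \<inter> (\<Inter>y\<in>M. {x. cinner x y = 0}))"
    using assms by (intro closed_Int closed_INT) (auto simp: closed_csubspace_def)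
  moreover have "orth_compl S M = S \<inter> (\<Inter>y\<in>M. {x. cinner x y = 0})"
    by (auto simp: orth_compl_def)
  ultimately show ?thesis
    using assms
    by (auto simp: closed_csubspace_def csubspace_def orth_compl_def cinner_add_left cinner_scaleC_left)
qed

lemma closed_csubspace_UNIV: "closed_csubspace UNIV"
  by (simp add: closed_csubspace_def csubspace_def)

lemma closed_csubspace_INT:
  assumes "\<And>i. i \<in> I \<Longrightarrow> closed_csubspace (A i)"
  shows "closed_csubspace (\<Inter>i\<in>I. A i)"
  using assms by (auto simp: closed_csubspace_def csubspace_def)

section \<open>Orthogonal projections\<close>

lemma nearest_point_exists:
  fixes x :: "'a::{complex_inner,complete_space}"
  assumes "closed_csubspace M"
  shows "\<exists>p\<in>M. \<forall>y\<in>M. norm (x - p) \<le> norm (x - y)"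
proof -
  have M: "csubspace M" "closed M" using assms by (auto simp: closed_csubspace_def)
  define D where "D = (\<lambda>y. (norm (x - y))\<^sup>2) ` M"
  define d where "d = Inf D"
  have ne: "D \<noteq> {}" using M by (auto simp: D_def csubspace_def)
  have bdd: "bdd_below D" unfolding D_def by (rule bdd_belowI[of _ 0]) auto
  have d_le: "d \<le> (norm (x - y))\<^sup>2" if "y \<in> M" for y
    unfolding d_def using that bdd by (intro cInf_lower) (auto simp: D_def)
  have "\<exists>y\<in>M. (norm (x - y))\<^sup>2 < d + inverse (real (Suc n))" for n
  proof -
    have "Inf D < d + inverse (real (Suc n))" by (simp add: d_def)
    then show ?thesis using cInf_less_iff[OF ne bdd] by (auto simp: D_def)
  qed
  then obtain Y where Y: "\<And>n. Y n \<in> M" "\<And>n. (norm (x - Y n))\<^sup>2 < d + inverse (real (Suc n))"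
    by metis
  \<comment> \<open>Parallelogram law for \<open>x - Y m\<close> and \<open>x - Y n\<close>: their
    sum is twice \<open>x - ?h\<close>, and the midpoint \<open>?h\<close> lies in \<open>M\<close>,
    so four times its squared distance is at least \<open>4 * d\<close> and only the two error terms
    remain.\<close>
  have par: "(norm (Y m - Y n))\<^sup>2 \<le> 2 * inverse (real (Suc m)) + 2 * inverse (real (Suc n))" for m n
  proof -
    let ?h = "(1/2::real) *\<^sub>R (Y m + Y n)"
    have "?h \<in> M" using Y(1) M by (auto simp: csubspace_def scaleR_scaleC)
    then have le: "d \<le> (norm (x - ?h))\<^sup>2" by (rule d_le)
    have "(x - Y m) + (x - Y n) = 2 *\<^sub>R (x - ?h)"
      by (simp add: algebra_simps scaleR_2)
    then have "(norm ((x - Y m) + (x - Y n)))\<^sup>2 = 4 * (norm (x - ?h))\<^sup>2"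
      by (simp add: power_mult_distrib)
    moreover have "(x - Y n) - (x - Y m) = Y m - Y n" by simp
    then have "(norm (Y m - Y n))\<^sup>2 = (norm ((x - Y n) - (x - Y m)))\<^sup>2" by simp
    ultimately show ?thesis
      using le Y(2)[of m] Y(2)[of n] norm_add_sq[of "x - Y m" "x - Y n"]
        norm_diff_sq[of "x - Y n" "x - Y m"] Re_cinner_commute[of "x - Y n" "x - Y m"] by linarith
  qed
  have "Cauchy Y"
  proof (rule metric_CauchyI)
    fix e :: real assume "0 < e"
    \<comment> \<open>Each of the two error terms in \<open>par\<close> is then below
      \<open>e\<^sup>2 / 2\<close>.\<close>
    then obtain N where N: "inverse (real (Suc N)) < e\<^sup>2 / 4"
      using reals_Archimedean[of "e\<^sup>2 / 4"] by auto
    have "dist (Y m) (Y n) < e" if "N \<le> m" "N \<le> n" for m n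
    proof -
      have "inverse (real (Suc m)) \<le> inverse (real (Suc N))"
        "inverse (real (Suc n)) \<le> inverse (real (Suc N))"
        using that by (auto intro!: le_imp_inverse_le)
      then have "(norm (Y m - Y n))\<^sup>2 < e\<^sup>2" using par[of m n] N by linarith
      then show ?thesis using \<open>0 < e\<close> by (simp add: dist_norm power_less_imp_less_base)
    qed
    then show "\<exists>M. \<forall>m\<ge>M. \<forall>n\<ge>M. dist (Y m) (Y n) < e" by blast
  qed
  then obtain p where p: "Y \<longlonglongrightarrow> p"
    using Cauchy_convergent convergent_def by blast
  have "p \<in> M" using closed_sequentially[OF M(2) _ p] Y(1) by blast
  have "(\<lambda>n. (norm (x - Y n))\<^sup>2) \<longlonglongrightarrow> (norm (x - p))\<^sup>2"
    by (intro tendsto_intros p)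
  moreover have "(\<lambda>n. d + inverse (real (Suc n))) \<longlonglongrightarrow> d + 0"
    by (intro tendsto_intros LIMSEQ_inverse_real_of_nat)
  ultimately have "(norm (x - p))\<^sup>2 \<le> d + 0"
    by (rule LIMSEQ_le) (intro exI allI impI less_imp_le Y(2))
  then have "(norm (x - p))\<^sup>2 \<le> (norm (x - y))\<^sup>2" if "y \<in> M" for y
    using d_le[OF that] by linarith
  then have "norm (x - p) \<le> norm (x - y)" if "y \<in> M" for y
    using that power2_le_imp_le norm_ge_zero by blast
  then show ?thesis using \<open>p \<in> M\<close> by blast
qed

lemma orthogonal_projection_exists:
  fixes x :: "'a::{complex_inner,complete_space}"
  assumes "closed_csubspace M"
  shows "\<exists>p\<in>M. x - p \<in> orth_compl UNIV M"
proof -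
  have M: "csubspace M" using assms by (auto simp: closed_csubspace_def)
  obtain p where p: "p \<in> M" "\<And>y. y \<in> M \<Longrightarrow> norm (x - p) \<le> norm (x - y)"
    using nearest_point_exists[OF assms] by blast
  have "cinner (x - p) y = 0" if "y \<in> M" for y
  proof (cases "y = 0")
    case False
    \<comment> \<open>\<open>c *\<^sub>C y\<close> is the component of \<open>x - p\<close> along
      \<open>y\<close>. Moving \<open>p\<close> by it cannot reduce the distance, which yields
      \<open>2 * t \<le> t\<close> for \<open>t = (cmod c * norm y)\<^sup>2\<close>, so
      \<open>c = 0\<close>.\<close>
    define c where "c = cinner y (x - p) / of_real ((norm y)\<^sup>2)"
    have "p + c *\<^sub>C y \<in> M" using M p(1) that by (auto simp: csubspace_def)
    from p(2)[OF this] have "(norm (x - p))\<^sup>2 \<le> (norm ((x - p) - c *\<^sub>C y))\<^sup>2"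
      by (simp add: diff_diff_eq)
    then have *: "2 * Re (c * cinner (x - p) y) \<le> (cmod c * norm y)\<^sup>2"
      by (simp add: norm_diff_sq norm_scaleC cinner_scaleC_right)
    have c: "cinner (x - p) y = cnj c * of_real ((norm y)\<^sup>2)"
      using False by (subst cinner_commute) (simp add: c_def)
    have "c * cinner (x - p) y = (c * cnj c) * of_real ((norm y)\<^sup>2)" by (simp add: c)
    also have "\<dots> = of_real ((cmod c * norm y)\<^sup>2)"
      by (simp add: complex_norm_square[symmetric] power_mult_distrib)
    finally have "2 * (cmod c * norm y)\<^sup>2 \<le> (cmod c * norm y)\<^sup>2" using * by simp
    then have "c = 0" using False by simp
    then show ?thesis using c by simp
  qed simp
  then show ?thesis using p(1) by (auto simp: orth_compl_def)
qed

text \<open>Project \<open>x\<close> onto \<open>M\<close>: the remainder \<open>x - p\<close> lies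
  in the complement within \<open>S\<close>, so it is orthogonal to both \<open>x\<close> and
  \<open>p\<close>, hence to itself. The version relative to \<open>S\<close> matches
  \<open>reducing_on\<close>.\<close>

lemma orth_compl_orth_compl:
  fixes M :: "'a::{complex_inner,complete_space} set"
  assumes "closed_csubspace M" "csubspace S" "M \<subseteq> S"
  shows "orth_compl S (orth_compl S M) = M"
proof
  show "orth_compl S (orth_compl S M) \<subseteq> M"
  proof
    fix x assume x: "x \<in> orth_compl S (orth_compl S M)"
    obtain p where p: "p \<in> M" "x - p \<in> orth_compl UNIV M"
      using orthogonal_projection_exists[OF assms(1)] by blast
    have "x - p \<in> orth_compl S M"
      using p x assms by (auto simp: orth_compl_def intro: csubspace_diff)
    then have "cinner x (x - p) = 0" using x by (auto simp: orth_compl_def)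
    moreover have "cinner p (x - p) = 0"
      using p by (subst cinner_commute) (auto simp: orth_compl_def)
    ultimately have "cinner (x - p) (x - p) = 0" by (simp add: cinner_diff_left)
    then show "x \<in> M" using p(1) by (simp add: cinner_self_eq_0_iff)
  qed
  have "cinner x y = 0" if "y \<in> orth_compl S M" "x \<in> M" for x y
    using that by (subst cinner_commute) (auto simp: orth_compl_def)
  then show "M \<subseteq> orth_compl S (orth_compl S M)"
    using assms(3) unfolding orth_compl_def by blast
qed

section \<open>Adjoints\<close>

lemma cbounded_on_UNIV_imp_bounded_linear:
  assumes "cbounded_on UNIV T"
  shows "bounded_linear T"
proof -
  obtain C where C: "\<And>x. norm (T x) \<le> C * norm x" using assms by (auto simp: cbounded_on_def)
  show ?thesis
    by (rule bounded_linear_intro[where K = C])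
      (use assms C in \<open>auto simp: cbounded_on_def scaleR_scaleC mult.commute\<close>)
qed

lemma cbounded_on_subset:
  assumes "cbounded_on S T" "M \<subseteq> S" "T ` M \<subseteq> M"
  shows "cbounded_on M T"
  using assms unfolding cbounded_on_def by (meson subsetD)

text \<open>Test vectors from \<open>M\<close> suffice because \<open>a - b\<close> is one of them.
  Linearity and uniqueness of adjoints are derived from this.\<close>

lemma eq_if_cinner_eq:
  assumes "csubspace M" "a \<in> M" "b \<in> M" "\<And>y. y \<in> M \<Longrightarrow> cinner y a = cinner y b"
  shows "a = b"
proof -
  have "cinner (a - b) (a - b) = 0"
    using assms csubspace_diff[OF assms(1-3)] by (subst cinner_diff_right) simp
  then show ?thesis by (simp add: cinner_self_eq_0_iff)
qed

lemma cinner_preserving_inj: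
  fixes J :: "'a::complex_inner \<Rightarrow> 'k::complex_inner"
  assumes iso: "\<And>x y. cinner (J x) (J y) = cinner x y" and "J x = J y"
  shows "x = y"
proof -
  have "csubspace (UNIV::'a set)" by (simp add: csubspace_def)
  then show ?thesis
    by (rule eq_if_cinner_eq) (use \<open>J x = J y\<close> in \<open>simp_all add: iso[symmetric]\<close>)
qed

lemma adjoint_on_swap:
  assumes "adjoint_on S T T'" "x \<in> S" "y \<in> S"
  shows "cinner (T' x) y = cinner x (T y)"
proof -
  have "cinner (T y) x = cinner y (T' x)" using assms by (simp add: adjoint_on_def)
  then have "cnj (cinner y (T' x)) = cnj (cinner (T y) x)" by simp
  then show ?thesis by (simp flip: cinner_commute)
qed

text \<open>\<open>Q\<close> is the adjoint of the restriction of \<open>J\<close> to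
  \<open>M\<close>: project \<open>z\<close> onto the image of \<open>M\<close> and pull back. The
  image is closed, being isometric to a complete space.\<close>

lemma isometry_adjoint_exists:
  fixes J :: "'a::{complex_inner,complete_space} \<Rightarrow> 'k::{complex_inner,complete_space}"
  assumes M: "closed_csubspace M"
    and add: "\<And>x y. J (x + y) = J x + J y"
    and scale: "\<And>c x. J (c *\<^sub>C x) = c *\<^sub>C J x"
    and iso: "\<And>x y. cinner (J x) (J y) = cinner x y"
  obtains Q where "\<And>z. Q z \<in> M" "\<And>y z. y \<in> M \<Longrightarrow> cinner (J y) z = cinner y (Q z)"
proof -
  have csub: "csubspace M" and "closed M" using M by (auto simp: closed_csubspace_def)
  have norm: "norm (J x) = norm x" for x by (simp add: norm_eq_sqrt_cinner iso)
  have "bounded_linear J"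
    by (rule bounded_linear_intro[where K = 1]) (auto simp: add scale scaleR_scaleC norm)
  then have "complete (J ` M)"
    using \<open>closed M\<close> csubspace_imp_subspace[OF csub]
    by (intro complete_isometric_image[where e = 1]) (auto simp: norm complete_eq_closed)
  moreover have "csubspace (J ` M)"
    unfolding csubspace_def
  proof (intro conjI ballI allI)
    have "J 0 = 0" using scale[of 0 0] by simp
    then show "0 \<in> J ` M" using csub by (force simp: csubspace_def)
  qed (use csub in \<open>auto simp: csubspace_def add[symmetric] scale[symmetric]\<close>)
  ultimately have JM: "closed_csubspace (J ` M)"
    by (simp add: closed_csubspace_def complete_eq_closed)
  have "\<exists>m\<in>M. \<forall>y\<in>M. cinner (J y) z = cinner y m" for z
  proof -
    obtain m where m: "m \<in> M" "z - J m \<in> orth_compl UNIV (J ` M)"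
      using orthogonal_projection_exists[OF JM, of z] by auto
    have "cinner (J y) z = cinner y m" if "y \<in> M" for y
    proof -
      have "cinner (J y) (z - J m) = 0"
        using m(2) that by (subst cinner_commute) (auto simp: orth_compl_def)
      then show ?thesis by (simp add: cinner_diff_right iso)
    qed
    then show ?thesis using m(1) by blast
  qed
  then show ?thesis using that by metis
qed

text \<open>The squared norm of \<open>T' y\<close> equals \<open>cinner (T (T' y)) y\<close>, hence
  is at most \<open>C * norm (T' y) * norm y\<close>; cancel one factor. Linearity follows from
  uniqueness of the adjoint.\<close>

lemma cbounded_on_adjoint:
  fixes T :: "'a::complex_inner \<Rightarrow> 'a"
  assumes T: "cbounded_on UNIV T" and adj: "\<And>x y. cinner (T x) y = cinner x (T' y)"
  shows "cbounded_on UNIV T'"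
proof -
  have U: "csubspace (UNIV::'a set)" by (simp add: csubspace_def)
  obtain C where C: "\<And>x. norm (T x) \<le> C * norm x" using T by (auto simp: cbounded_on_def)
  have "norm (T' y) \<le> C * norm y" for y
  proof (cases "T' y = 0")
    case True
    \<comment> \<open>The sign of \<open>C\<close> is not prescribed, so nonnegativity of the bound
      comes from \<open>C\<close> dominating a norm.\<close>
    have "0 \<le> C * norm y" using C[of y] norm_ge_zero order_trans by blast
    then show ?thesis using True by simp
  next
    case False
    have "(norm (T' y))\<^sup>2 = Re (cinner (T (T' y)) y)" by (simp add: norm_sq_eq_cinner adj)
    also have "\<dots> \<le> norm (T (T' y)) * norm y" by (rule Re_cinner_le)
    also have "\<dots> \<le> (C * norm (T' y)) * norm y" by (intro mult_right_mono C) simp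
    finally have "norm (T' y) * norm (T' y) \<le> norm (T' y) * (C * norm y)"
      by (simp add: power2_eq_square mult_ac)
    then show ?thesis using False by simp
  qed
  moreover have "T' (x + y) = T' x + T' y" for x y
    by (rule eq_if_cinner_eq[OF U]) (simp_all add: adj[symmetric] cinner_add_right)
  moreover have "T' (c *\<^sub>C x) = c *\<^sub>C T' x" for c x
    by (rule eq_if_cinner_eq[OF U]) (simp_all add: adj[symmetric] cinner_scaleC_right)
  ultimately show ?thesis by (auto simp: cbounded_on_def)
qed

section \<open>Invariant and reducing subspaces in terms of adjoints\<close>

lemma adjoint_preserves_orth_compl:
  assumes "adjoint_on UNIV T T'"
  shows "T' ` M \<subseteq> M \<Longrightarrow> T ` orth_compl UNIV M \<subseteq> orth_compl UNIV M"
    and "T ` M \<subseteq> M \<Longrightarrow> T' ` orth_compl UNIV M \<subseteq> orth_compl UNIV M"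
proof -
  have "cinner (T x) y = cinner x (T' y)" "cinner (T' x) y = cinner x (T y)" for x y
    using assms adjoint_on_swap[OF assms] by (auto simp: adjoint_on_def)
  then show "T' ` M \<subseteq> M \<Longrightarrow> T ` orth_compl UNIV M \<subseteq> orth_compl UNIV M"
    "T ` M \<subseteq> M \<Longrightarrow> T' ` orth_compl UNIV M \<subseteq> orth_compl UNIV M"
    by (auto simp: orth_compl_def)
qed

lemma reducing_onI:
  assumes "adjoint_on UNIV T T'" "closed_csubspace M" "M \<subseteq> S"
    "T ` S \<subseteq> S" "T ` M \<subseteq> M" "T' ` M \<subseteq> M"
  shows "reducing_on S M T"
  using assms unfolding reducing_on_def orth_compl_def adjoint_on_def by auto

text \<open>\<open>reducing_on\<close> speaks of the complement, not of the adjoint. If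
  \<open>y\<close> is in the complement, so is \<open>T y\<close>, hence \<open>T' m\<close> is
  orthogonal to \<open>y\<close>; thus \<open>T' m\<close> lies in the double complement, which is
  \<open>M\<close>.\<close>

lemma reducing_on_adjoint_invariant:
  fixes T :: "'a::{complex_inner,complete_space} \<Rightarrow> 'a"
  assumes adj: "adjoint_on UNIV T T'" and red: "reducing_on S M T"
    and S: "csubspace S" "T' ` S \<subseteq> S"
  shows "T' ` M \<subseteq> M"
proof
  fix z assume "z \<in> T' ` M"
  then obtain m where m: "m \<in> M" "z = T' m" by auto
  have M: "closed_csubspace M" "M \<subseteq> S" using red by (auto simp: reducing_on_def)
  have "cinner z y = 0" if y: "y \<in> orth_compl S M" for y
  proof -
    have "T y \<in> orth_compl S M" using red y by (auto simp: reducing_on_def)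
    then have "cinner (T y) m = 0" using m by (auto simp: orth_compl_def)
    then have "cinner y z = 0" using adj m by (auto simp: adjoint_on_def)
    then show ?thesis by (subst cinner_commute) simp
  qed
  then have "z \<in> orth_compl S (orth_compl S M)"
    using m M S by (auto simp: orth_compl_def)
  then show "z \<in> M" using orth_compl_orth_compl[OF M(1) S(1) M(2)] by simp
qed

text \<open>On a subspace invariant under \<open>T\<close> and \<open>T'\<close>, the adjoint of the
  restriction is the restriction of \<open>T'\<close>. Normality there becomes an identity in the
  global adjoint, with no adjoint left to choose.\<close>

lemma normal_on_restrict_iff:
  assumes T: "cbounded_on UNIV T" and adj: "adjoint_on UNIV T T'"
    and M: "csubspace M" "T ` M \<subseteq> M" "T' ` M \<subseteq> M"
  shows "normal_on M T \<longleftrightarrow> (\<forall>x\<in>M. T (T' x) = T' (T x))"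
proof
  assume "normal_on M T"
  then obtain T'' where T'': "adjoint_on M T T''" "\<forall>x\<in>M. T (T'' x) = T'' (T x)"
    by (auto simp: normal_on_def)
  have "T'' x = T' x" if "x \<in> M" for x
    using that M T'' adj
    by (intro eq_if_cinner_eq[OF M(1)]) (auto simp: adjoint_on_def cbounded_on_def)
  then show "\<forall>x\<in>M. T (T' x) = T' (T x)" using T'' M by (metis image_subset_iff)
next
  assume "\<forall>x\<in>M. T (T' x) = T' (T x)"
  moreover have "adjoint_on M T T'"
    using adj cbounded_on_subset[of UNIV T' M] M by (auto simp: adjoint_on_def)
  ultimately show "normal_on M T"
    using cbounded_on_subset[OF T] M unfolding normal_on_def by blast
qed

section \<open>Normal restrictions of subnormal triples\<close>

text \<open>Every stage is one chase: carry a cycle from \<open>M\<close> to \<open>K\<close> by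
  \<open>J\<close>, solve it there, and pull the solution back by \<open>Q\<close>. Since
  \<open>Q\<close> intertwines the operators and inverts \<open>J\<close> on \<open>M\<close>, the
  result solves the original equation.\<close>

lemma koszul_exact_retract:
  assumes ex: "koszul_exact K A B C"
    and I: "\<And>x. x \<in> M \<Longrightarrow> J x \<in> K" and Q: "\<And>z. z \<in> K \<Longrightarrow> Q z \<in> M"
    and QJ: "\<And>x. x \<in> M \<Longrightarrow> Q (J x) = x"
    and J_add: "\<And>x y. J (x + y) = J x + J y" and J_diff: "\<And>x y. J (x - y) = J x - J y"
    and Q_add: "\<And>x y. Q (x + y) = Q x + Q y" and Q_diff: "\<And>x y. Q (x - y) = Q x - Q y"
    and J_int: "\<And>x. x \<in> M \<Longrightarrow> A (J x) = J (A' x) \<and> B (J x) = J (B' x) \<and> C (J x) = J (C' x)"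
    and Q_int: "\<And>z. z \<in> K \<Longrightarrow> Q (A z) = A' (Q z) \<and> Q (B z) = B' (Q z) \<and> Q (C z) = C' (Q z)"
  shows "koszul_exact M A' B' C'"
proof -
  have J0: "J 0 = 0" using J_diff[of 0 0] by simp
  have Q0: "Q 0 = 0" using Q_diff[of 0 0] by simp
  note ex1 = ex[unfolded koszul_exact_def, THEN conjunct1, rule_format]
  note ex2 = ex[unfolded koszul_exact_def, THEN conjunct2, THEN conjunct1, rule_format]
  note ex3 = ex[unfolded koszul_exact_def, THEN conjunct2, THEN conjunct2, THEN conjunct1, rule_format]
  note ex4 = ex[unfolded koszul_exact_def, THEN conjunct2, THEN conjunct2, THEN conjunct2, rule_format]
  show ?thesis
    unfolding koszul_exact_def
  proof (intro conjI ballI impI)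
    fix x assume x: "x \<in> M" "A' x = 0 \<and> B' x = 0 \<and> C' x = 0"
    then have "J x = 0" using J_int[OF x(1)] J0 by (intro ex1[OF I[OF x(1)]]) simp
    then show "x = 0" using QJ[OF x(1)] Q0 by simp
  next
    fix x1 x2 x3 assume x: "x1 \<in> M" "x2 \<in> M" "x3 \<in> M"
      and eq: "A' x2 - B' x1 = 0 \<and> A' x3 - C' x1 = 0 \<and> B' x3 - C' x2 = 0"
    have "A (J x2) - B (J x1) = 0 \<and> A (J x3) - C (J x1) = 0 \<and> B (J x3) - C (J x2) = 0"
      using eq by (simp add: J_int x)
    then obtain z where z: "z \<in> K" "J x1 = A z" "J x2 = B z" "J x3 = C z"
      using ex2[OF I[OF x(1)] I[OF x(2)] I[OF x(3)]] by blast
    have "x1 = A' (Q z)" "x2 = B' (Q z)" "x3 = C' (Q z)"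
      using z Q_int[OF z(1)] QJ[OF x(1)] QJ[OF x(2)] QJ[OF x(3)] by simp_all
    then show "\<exists>x\<in>M. x1 = A' x \<and> x2 = B' x \<and> x3 = C' x" using Q[OF z(1)] by blast
  next
    fix y12 y13 y23 assume y: "y12 \<in> M" "y13 \<in> M" "y23 \<in> M"
      and eq: "A' y23 - B' y13 + C' y12 = 0"
    have "A (J y23) - B (J y13) + C (J y12) = J (A' y23 - B' y13 + C' y12)"
      by (simp add: J_int y J_add J_diff)
    then have "A (J y23) - B (J y13) + C (J y12) = 0" using eq J0 by simp
    then obtain x1 x2 x3 where x: "x1 \<in> K" "x2 \<in> K" "x3 \<in> K" "J y12 = A x2 - B x1"
      "J y13 = A x3 - C x1" "J y23 = B x3 - C x2"
      using ex3[OF I[OF y(1)] I[OF y(2)] I[OF y(3)]] by blast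
    have "Q (J y12) = A' (Q x2) - B' (Q x1)" "Q (J y13) = A' (Q x3) - C' (Q x1)"
      "Q (J y23) = B' (Q x3) - C' (Q x2)"
      unfolding x(4-6) by (simp_all add: Q_diff Q_int x(1-3))
    then show "\<exists>x1\<in>M. \<exists>x2\<in>M. \<exists>x3\<in>M. y12 = A' x2 - B' x1 \<and> y13 = A' x3 - C' x1 \<and> y23 = B' x3 - C' x2"
      using Q[OF x(1)] Q[OF x(2)] Q[OF x(3)] QJ y by metis
  next
    fix z assume z: "z \<in> M"
    obtain y12 y13 y23 where y: "y12 \<in> K" "y13 \<in> K" "y23 \<in> K"
      "J z = A y23 - B y13 + C y12"
      using ex4[OF I[OF z]] by blast
    have "Q (J z) = A' (Q y23) - B' (Q y13) + C' (Q y12)"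
      unfolding y(4) by (simp add: Q_diff Q_add Q_int y(1-3))
    then show "\<exists>y12\<in>M. \<exists>y13\<in>M. \<exists>y23\<in>M. z = A' y23 - B' y13 + C' y12"
      using Q[OF y(1)] Q[OF y(2)] Q[OF y(3)] QJ[OF z] by metis
  qed
qed

text \<open>A normal restriction of a normal operator is reducing: the adjoint of the restriction is the
  compression of \<open>U\<^sup>*\<close>, and normality on both sides forces the two to have equal norms.\<close>

lemma adjoint_intertwines_of_normal_restriction:
  assumes iso: "\<And>x y. cinner (J x) (J y) = cinner x y"
    and JK: "\<And>x. J x \<in> K"
    and U: "cbounded_on K U" "adjoint_on K U U'" "\<forall>x\<in>K. U (U' x) = U' (U x)"
    and V: "cbounded_on M V" "adjoint_on M V V'" "\<forall>x\<in>M. V (V' x) = V' (V x)"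
    and int: "\<And>x. U (J x) = J (V x)"
    and y: "y \<in> M"
  shows "U' (J y) = J (V' y)"
proof -
  have adjU: "cinner (U a) b = cinner a (U' b)" "U' a \<in> K" "U a \<in> K" if "a \<in> K" "b \<in> K" for a b
    using U that by (auto simp: adjoint_on_def cbounded_on_def)
  have adjV: "cinner (V a) b = cinner a (V' b)" "V' a \<in> M" "V a \<in> M" if "a \<in> M" "b \<in> M" for a b
    using V that by (auto simp: adjoint_on_def cbounded_on_def)
  \<comment> \<open>All four terms in the expansion of the squared norm of
    \<open>U' (J y) - J (V' y)\<close> are shown to equal \<open>cinner (V' y) (V' y)\<close>.
    Normality enters here, replacing \<open>U'\<close> by \<open>U\<close> and then \<open>V\<close>
    by \<open>V'\<close>.\<close>
  have "cinner (U' (J y)) (U' (J y)) = cinner (U (U' (J y))) (J y)"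
    using adjU JK by metis
  also have "\<dots> = cinner (U' (U (J y))) (J y)" by (simp add: U(3) JK)
  also have "\<dots> = cinner (U (J y)) (U (J y))"
    by (rule adjoint_on_swap[OF U(2) adjU(3)[OF JK JK] JK])
  also have "\<dots> = cinner (V y) (V y)" by (simp add: int iso)
  also have "\<dots> = cinner (V' (V y)) y"
    by (rule adjoint_on_swap[OF V(2) adjV(3)[OF y y] y, symmetric])
  also have "\<dots> = cinner (V (V' y)) y" by (simp add: V(3) y)
  also have "\<dots> = cinner (V' y) (V' y)" using adjV y by metis
  finally have 1: "cinner (U' (J y)) (U' (J y)) = cinner (V' y) (V' y)" .
  have "cinner (J (V' y)) (U' (J y)) = cinner (U (J (V' y))) (J y)"
    using adjU JK by metis
  also have "\<dots> = cinner (V (V' y)) y" by (simp add: int iso)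
  also have "\<dots> = cinner (V' y) (V' y)" using adjV y by metis
  finally have 2: "cinner (J (V' y)) (U' (J y)) = cinner (V' y) (V' y)" .
  have 3: "cinner (U' (J y)) (J (V' y)) = cinner (V' y) (V' y)"
    using 2 by (metis cinner_commute)
  have "cinner (U' (J y) - J (V' y)) (U' (J y) - J (V' y)) = 0"
    using 1 2 3 by (simp add: cinner_diff_left cinner_diff_right iso)
  then show ?thesis by (simp add: cinner_self_eq_0_iff)
qed

text \<open>\<open>J\<close> and its adjoint \<open>Q\<close> onto \<open>M\<close> form the pair
  required by \<open>koszul_exact_retract\<close>, so every point outside the spectrum on
  \<open>K\<close> is outside the spectrum on \<open>M\<close>.\<close>

lemma P_unitary_on_if_normal_restriction:
  fixes J :: "'a::{complex_inner,complete_space} \<Rightarrow> 'k::{complex_inner,complete_space}"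
  assumes add: "\<And>x y. J (x + y) = J x + J y"
    and scale: "\<And>c x. J (c *\<^sub>C x) = c *\<^sub>C J x"
    and iso: "\<And>x y. cinner (J x) (J y) = cinner x y"
    and JK: "\<And>x. J x \<in> K"
    and U: "P_unitary_on K U1 U2 U3"
    and int: "\<And>x. U1 (J x) = J (V1 x)" "\<And>x. U2 (J x) = J (V2 x)" "\<And>x. U3 (J x) = J (V3 x)"
    and M: "closed_csubspace M"
    and V: "normal_on M V1" "normal_on M V2" "normal_on M V3"
  shows "P_unitary_on M V1 V2 V3"
proof -
  have csub: "csubspace M" using M by (simp add: closed_csubspace_def)
  have diff: "J (x - y) = J x - J y" for x y using add[of "x - y" y] by simp
  have inj: "x = y" if "J x = J y" for x y by (rule cinner_preserving_inj[OF iso that])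
  obtain Q where Q: "\<And>z. Q z \<in> M" "\<And>y z. y \<in> M \<Longrightarrow> cinner (J y) z = cinner y (Q z)"
    using isometry_adjoint_exists[OF M add scale iso] by metis
  note cs = csub[unfolded csubspace_def]
  have Q_add: "Q (x + y) = Q x + Q y" for x y
    by (rule eq_if_cinner_eq[OF csub])
      (use cs Q(1) in \<open>auto simp: Q(2)[symmetric] cinner_add_right\<close>)
  have Q_scale: "Q (c *\<^sub>C x) = c *\<^sub>C Q x" for c x
    by (rule eq_if_cinner_eq[OF csub])
      (use cs Q(1) in \<open>auto simp: Q(2)[symmetric] cinner_scaleC_right\<close>)
  have Q_diff: "Q (x - y) = Q x - Q y" for x y using Q_add[of "x - y" y] by simp
  have QJ: "Q (J x) = x" if "x \<in> M" for x
    by (rule eq_if_cinner_eq[OF csub]) (use that Q(1) in \<open>auto simp: Q(2)[symmetric] iso\<close>)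
  \<comment> \<open>That \<open>Q\<close> intertwines is dual to \<open>U' (J y) = J (V' y)\<close>;
    this is where normality of both operators is used.\<close>
  have Q_int: "Q (U z) = V (Q z)"
    if z: "z \<in> K" and nU: "normal_on K U" and nV: "normal_on M V" and i: "\<And>x. U (J x) = J (V x)"
    for U V z
  proof -
    obtain U' where U': "cbounded_on K U" "adjoint_on K U U'" "\<forall>x\<in>K. U (U' x) = U' (U x)"
      using nU by (auto simp: normal_on_def)
    obtain V' where V': "cbounded_on M V" "adjoint_on M V V'" "\<forall>x\<in>M. V (V' x) = V' (V x)"
      using nV by (auto simp: normal_on_def)
    have VM: "V x \<in> M" "V' x \<in> M" if "x \<in> M" for x
      using V' that by (auto simp: adjoint_on_def cbounded_on_def)
    show ?thesis
    proof (rule eq_if_cinner_eq[OF csub Q(1) VM(1)[OF Q(1)]])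
      fix y assume y: "y \<in> M"
      have "cinner y (Q (U z)) = cinner (J y) (U z)" by (simp add: Q(2) y)
      also have "\<dots> = cinner (U' (J y)) z"
        by (simp add: adjoint_on_swap[OF U'(2) JK z])
      also have "\<dots> = cinner (J (V' y)) z"
        using adjoint_intertwines_of_normal_restriction[OF iso JK U' V' i y] by simp
      also have "\<dots> = cinner (V' y) (Q z)" by (simp add: Q(2) VM(2)[OF y])
      also have "\<dots> = cinner y (V (Q z))"
        by (rule adjoint_on_swap[OF V'(2) y Q(1)])
      finally show "cinner y (Q (U z)) = cinner y (V (Q z))" .
    qed
  qed
  have nU: "normal_on K U1" "normal_on K U2" "normal_on K U3"
    and cU: "commute_on K U1 U2" "commute_on K U1 U3" "commute_on K U2 U3"
    using U by (auto simp: P_unitary_on_def)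
  have "commute_on M V1 V2" "commute_on M V1 V3" "commute_on M V2 V3"
    using cU JK unfolding commute_on_def by (metis inj int)+
  \<comment> \<open>\<open>J\<close> and \<open>Q\<close> are complex linear, so they also
    intertwine the operators shifted by \<open>l1\<close>, \<open>l2\<close>,
    \<open>l3\<close>.\<close>
  moreover have "koszul_exact M (\<lambda>x. V1 x - l1 *\<^sub>C x) (\<lambda>x. V2 x - l2 *\<^sub>C x) (\<lambda>x. V3 x - l3 *\<^sub>C x)"
    if "koszul_exact K (\<lambda>x. U1 x - l1 *\<^sub>C x) (\<lambda>x. U2 x - l2 *\<^sub>C x) (\<lambda>x. U3 x - l3 *\<^sub>C x)" for l1 l2 l3
    by (rule koszul_exact_retract[OF that, where J = J and Q = Q])
      (simp_all add: JK Q(1) QJ add diff Q_add Q_diff int scale Q_scale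
        Q_int[OF _ nU(1) V(1) int(1)] Q_int[OF _ nU(2) V(2) int(2)] Q_int[OF _ nU(3) V(3) int(3)])
  then have "taylor_spectrum M V1 V2 V3 \<subseteq> taylor_spectrum K U1 U2 U3"
    unfolding taylor_spectrum_def by blast
  then have "taylor_spectrum M V1 V2 V3 \<subseteq> bPenta"
    using U by (auto simp: P_unitary_on_def)
  ultimately show ?thesis using M V by (simp add: P_unitary_on_def)
qed

text \<open>\<open>P_isometry_on\<close> does not list linearity or boundedness of the operators;
  both are inherited from \<open>U\<close> along the isometry \<open>J\<close>. The adjoint is the
  compression of \<open>U'\<close>, namely \<open>Q (U' (J y))\<close>.\<close>

lemma subnormal_adjoint_exists:
  fixes J :: "'a::{complex_inner,complete_space} \<Rightarrow> 'k::{complex_inner,complete_space}"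
  assumes add: "\<And>x y. J (x + y) = J x + J y"
    and scale: "\<And>c x. J (c *\<^sub>C x) = c *\<^sub>C J x"
    and iso: "\<And>x y. cinner (J x) (J y) = cinner x y"
    and JK: "\<And>x. J x \<in> K"
    and U: "normal_on K U"
    and int: "\<And>x. U (J x) = J (V x)"
  obtains V' where "cbounded_on UNIV V" "adjoint_on UNIV V V'"
proof -
  have inj: "x = y" if "J x = J y" for x y by (rule cinner_preserving_inj[OF iso that])
  have norm: "norm (J x) = norm x" for x by (simp add: norm_eq_sqrt_cinner iso)
  obtain U' where U': "cbounded_on K U" "adjoint_on K U U'" using U by (auto simp: normal_on_def)
  obtain C where C: "\<And>x. x \<in> K \<Longrightarrow> norm (U x) \<le> C * norm x" using U' unfolding cbounded_on_def by blast
  have "norm (V x) \<le> C * norm x" for x using C[OF JK, of x] by (simp add: int norm)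
  moreover have "V (x + y) = V x + V y" for x y
    by (rule inj) (use U' JK in \<open>simp add: int[symmetric] add cbounded_on_def\<close>)
  moreover have "V (c *\<^sub>C x) = c *\<^sub>C V x" for c x
    by (rule inj) (use U' JK in \<open>simp add: int[symmetric] scale cbounded_on_def\<close>)
  ultimately have V: "cbounded_on UNIV V" by (auto simp: cbounded_on_def)
  obtain Q where Q: "\<And>y z. cinner (J y) z = cinner y (Q z)"
    using isometry_adjoint_exists[OF closed_csubspace_UNIV add scale iso] by (metis UNIV_I)
  have adj: "cinner (V x) y = cinner x (Q (U' (J y)))" for x y
  proof -
    have "cinner (V x) y = cinner (U (J x)) (J y)" by (simp add: int iso)
    also have "\<dots> = cinner (J x) (U' (J y))" using U' JK by (auto simp: adjoint_on_def)
    finally show ?thesis by (simp add: Q)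
  qed
  show ?thesis
    by (rule that[OF V, of "\<lambda>y. Q (U' (J y))"])
      (use cbounded_on_adjoint[OF V adj] adj in \<open>simp add: adjoint_on_def\<close>)
qed

section \<open>The normal part of a family of operators\<close>

text \<open>Generators are added on the inside, so a word applied to \<open>T x\<close> is again a
  word applied to \<open>x\<close>. This makes the normal part invariant at once.\<close>

inductive_set words :: "('a \<Rightarrow> 'a) set \<Rightarrow> ('a \<Rightarrow> 'a) set" for G where
  words_id: "(\<lambda>x. x) \<in> words G"
| words_step: "w \<in> words G \<Longrightarrow> T \<in> G \<Longrightarrow> (\<lambda>x. w (T x)) \<in> words G"

text \<open>The pairs in \<open>F\<close> are meant to be operators with their adjoints. Quantifying
  over words yields the largest set that is invariant under all of them and on which each pair
  commutes.\<close>

definition normal_part :: "(('a \<Rightarrow> 'a) \<times> ('a \<Rightarrow> 'a)) set \<Rightarrow> 'a set" where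
  "normal_part F = {x. \<forall>w\<in>words (fst ` F \<union> snd ` F). \<forall>(T, T')\<in>F. T (T' (w x)) = T' (T (w x))}"

lemma normal_partI:
  assumes "\<And>w T T'. w \<in> words (fst ` F \<union> snd ` F) \<Longrightarrow> (T, T') \<in> F \<Longrightarrow> T (T' (w x)) = T' (T (w x))"
  shows "x \<in> normal_part F"
  using assms by (auto simp: normal_part_def)

lemma normal_partD:
  assumes "x \<in> normal_part F" "w \<in> words (fst ` F \<union> snd ` F)" "(T, T') \<in> F"
  shows "T (T' (w x)) = T' (T (w x))"
  using assms by (auto simp: normal_part_def)

lemma normal_part_invariant:
  assumes "(T, T') \<in> F"
  shows "T ` normal_part F \<subseteq> normal_part F" "T' ` normal_part F \<subseteq> normal_part F"
proof -
  have "R x \<in> normal_part F" if "R \<in> fst ` F \<union> snd ` F" "x \<in> normal_part F" for R x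
    by (rule normal_partI) (rule normal_partD[OF that(2) words_step[OF _ that(1)]])
  moreover have "T \<in> fst ` F \<union> snd ` F" "T' \<in> fst ` F \<union> snd ` F" using assms by force+
  ultimately show "T ` normal_part F \<subseteq> normal_part F" "T' ` normal_part F \<subseteq> normal_part F"
    by blast+
qed

lemma normal_part_commutes:
  assumes "(T, T') \<in> F" "x \<in> normal_part F"
  shows "T (T' x) = T' (T x)"
  by (rule normal_partD[OF assms(2) words_id assms(1)])

lemma subset_normal_part:
  assumes "\<And>T T'. (T, T') \<in> F \<Longrightarrow> T ` M \<subseteq> M \<and> T' ` M \<subseteq> M \<and> (\<forall>x\<in>M. T (T' x) = T' (T x))"
  shows "M \<subseteq> normal_part F"
proof
  fix x assume x: "x \<in> M"
  \<comment> \<open>The vector stays quantified in the induction because the hypothesis is used at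
    \<open>T x\<close>.\<close>
  have "\<forall>x\<in>M. w x \<in> M" if "w \<in> words (fst ` F \<union> snd ` F)" for w
    using that
  proof induction
    case (words_step w T)
    then obtain p where "p \<in> F" "T = fst p \<or> T = snd p" by auto
    then have "T ` M \<subseteq> M" using assms[of "fst p" "snd p"] by auto
    then show ?case using words_step.IH by auto
  qed simp
  then show "x \<in> normal_part F" using assms x by (blast intro: normal_partI)
qed

text \<open>Words are bounded operators, so each defining condition is the equalizer of two bounded
  operators; the normal part is the intersection of these closed subspaces.\<close>

lemma closed_csubspace_normal_part:
  assumes F: "\<And>T T'. (T, T') \<in> F \<Longrightarrow> cbounded_on UNIV T \<and> cbounded_on UNIV T'"
  shows "closed_csubspace (normal_part F)"
proof -
  have lin: "R (x + y) = R x + R y" "R (c *\<^sub>C x) = c *\<^sub>C R x" "continuous_on UNIV R"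
    if "cbounded_on UNIV R" for R :: "'a \<Rightarrow> 'a" and x y c
    using that cbounded_on_UNIV_imp_bounded_linear[OF that]
    by (auto simp: cbounded_on_def intro: linear_continuous_on)
  have comp: "cbounded_on UNIV (\<lambda>x. R (R' x))"
    if "cbounded_on UNIV R" "cbounded_on UNIV R'" for R R' :: "'a \<Rightarrow> 'a"
  proof -
    have "bounded_linear (\<lambda>x. R (R' x))"
      using bounded_linear_compose[of R R'] that cbounded_on_UNIV_imp_bounded_linear by blast
    from bounded_linear.bounded[OF this]
    have "\<exists>C. \<forall>x. norm (R (R' x)) \<le> C * norm x" by (simp only: mult.commute)
    then show ?thesis using lin(1,2)[OF that(1)] lin(1,2)[OF that(2)] by (simp add: cbounded_on_def)
  qed
  have w: "cbounded_on UNIV w" if "w \<in> words (fst ` F \<union> snd ` F)" for w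
    using that
  proof induction
    case words_id
    have "\<exists>C. \<forall>x::'a. norm x \<le> C * norm x" by (rule exI[of _ 1]) simp
    then show ?case by (simp add: cbounded_on_def)
  next
    case (words_step w T)
    then have "cbounded_on UNIV T" using F by auto
    then show ?case by (rule comp[OF words_step.IH])
  qed
  let ?E = "\<lambda>w (T, T'). {x. T (T' (w x)) = T' (T (w x))}"
  have E: "closed_csubspace (?E w (T, T'))"
    if "w \<in> words (fst ` F \<union> snd ` F)" "(T, T') \<in> F" for w T T'
  proof -
    have 1: "cbounded_on UNIV (\<lambda>x. T (T' (w x)))" "cbounded_on UNIV (\<lambda>x. T' (T (w x)))"
      using comp[of T "\<lambda>x. T' (w x)"] comp[of T' "\<lambda>x. T (w x)"] comp[of T' w] comp[of T w]
        F[OF that(2)] w[OF that(1)] by blast+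
    have "T (T' (w 0)) = 0" "T' (T (w 0)) = 0"
      using lin(2)[OF 1(1), of 0 0] lin(2)[OF 1(2), of 0 0] by simp_all
    then show ?thesis
      using lin(1,2)[OF 1(1)] lin(1,2)[OF 1(2)] closed_Collect_eq[OF lin(3)[OF 1(1)] lin(3)[OF 1(2)]]
      by (simp add: closed_csubspace_def csubspace_def)
  qed
  have "normal_part F = (\<Inter>(w, p)\<in>words (fst ` F \<union> snd ` F) \<times> F. ?E w p)"
    by (auto simp: normal_part_def)
  also have "closed_csubspace \<dots>" using E by (intro closed_csubspace_INT) auto
  finally show ?thesis .
qed

section \<open>Existence, maximality and uniqueness of the unitary part\<close>

theorem mainTheorem3:
  fixes V1 V2 V3 :: "'a::{complex_inner,complete_space} \<Rightarrow> 'a"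
  assumes "P_isometry_on TYPE('k::{complex_inner,complete_space}) UNIV V1 V2 V3"
  shows "\<exists>!(Hu, Hc). closed_csubspace Hu \<and> closed_csubspace Hc \<and>
            Hc = orth_compl UNIV Hu \<and>
            reducing_on UNIV Hu V1 \<and> reducing_on UNIV Hu V2 \<and> reducing_on UNIV Hu V3 \<and>
            reducing_on UNIV Hc V1 \<and> reducing_on UNIV Hc V2 \<and> reducing_on UNIV Hc V3 \<and>
            P_unitary_on Hu V1 V2 V3 \<and>
            pure_P_isometry_on TYPE('k) Hc V1 V2 V3"
proof -
  obtain J :: "'a \<Rightarrow> 'k" and K U1 U2 U3 where
    J: "\<And>x y. J (x + y) = J x + J y" "\<And>c x. J (c *\<^sub>C x) = c *\<^sub>C J x"
      "\<And>x y. cinner (J x) (J y) = cinner x y" "\<And>x. J x \<in> K"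
    and U: "P_unitary_on K U1 U2 U3"
    and int: "\<And>x. U1 (J x) = J (V1 x)" "\<And>x. U2 (J x) = J (V2 x)" "\<And>x. U3 (J x) = J (V3 x)"
    using assms unfolding P_isometry_on_def by (simp add: image_subset_iff) metis
  have nU: "normal_on K U1" "normal_on K U2" "normal_on K U3"
    using U by (auto simp: P_unitary_on_def)
  obtain V1' where V1: "cbounded_on UNIV V1" "adjoint_on UNIV V1 V1'"
    using subnormal_adjoint_exists[OF J nU(1) int(1)] by metis
  obtain V2' where V2: "cbounded_on UNIV V2" "adjoint_on UNIV V2 V2'"
    using subnormal_adjoint_exists[OF J nU(2) int(2)] by metis
  obtain V3' where V3: "cbounded_on UNIV V3" "adjoint_on UNIV V3 V3'"
    using subnormal_adjoint_exists[OF J nU(3) int(3)] by metis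
  define F where "F = {(V1, V1'), (V2, V2'), (V3, V3')}"
  have F: "cbounded_on UNIV T" "adjoint_on UNIV T T'" if "(T, T') \<in> F" for T T'
    using that V1 V2 V3 by (auto simp: F_def)
  have V_F: "(V1, V1') \<in> F" "(V2, V2') \<in> F" "(V3, V3') \<in> F" by (auto simp: F_def)
  define Hu where "Hu = normal_part F"
  define Hc where "Hc = orth_compl UNIV Hu"
  have csub_UNIV: "csubspace (UNIV::'a set)" by (simp add: csubspace_def)
  have Hu: "closed_csubspace Hu"
    unfolding Hu_def using F by (intro closed_csubspace_normal_part) (auto simp: adjoint_on_def)
  have Hc: "closed_csubspace Hc"
    unfolding Hc_def by (rule closed_csubspace_orth_compl[OF closed_csubspace_UNIV])
  have Hu_inv: "T ` Hu \<subseteq> Hu" "T' ` Hu \<subseteq> Hu" if "(T, T') \<in> F" for T T'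
    using normal_part_invariant[OF that] by (simp_all add: Hu_def)
  have Hc_inv: "T ` Hc \<subseteq> Hc" "T' ` Hc \<subseteq> Hc" if "(T, T') \<in> F" for T T'
    using adjoint_preserves_orth_compl[OF F(2)[OF that]] Hu_inv[OF that] by (simp_all add: Hc_def)
  have red: "reducing_on S M T"
    if "(T, T') \<in> F" "closed_csubspace M" "M \<subseteq> S" "T ` S \<subseteq> S" "T ` M \<subseteq> M" "T' ` M \<subseteq> M" for S M T T'
    using reducing_onI[OF F(2)] that by blast
  \<comment> \<open>Stated for subspaces of \<open>Hu\<close> because it serves twice: for
    \<open>Hu\<close> itself and for its intersection with the complement of a competitor.\<close>
  have unit: "P_unitary_on M V1 V2 V3"
    if M: "closed_csubspace M" "M \<subseteq> Hu" and inv: "\<And>T T'. (T, T') \<in> F \<Longrightarrow> T ` M \<subseteq> M \<and> T' ` M \<subseteq> M" for M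
  proof -
    have "normal_on M T" if T: "(T, T') \<in> F" for T T'
      using normal_on_restrict_iff[OF F[OF T], of M] inv[OF T] M normal_part_commutes[OF T]
      by (auto simp: closed_csubspace_def Hu_def)
    then show ?thesis
      using P_unitary_on_if_normal_restriction[OF J U int M(1)] V_F by blast
  qed
  \<comment> \<open>The ambient space \<open>S\<close> is left open: it is \<open>Hc\<close> in the
    proof of purity and the whole space in the proof of uniqueness.\<close>
  have maximal: "M \<subseteq> Hu"
    if P: "P_unitary_on M V1 V2 V3"
      and S: "csubspace S" "\<And>T T'. (T, T') \<in> F \<Longrightarrow> T' ` S \<subseteq> S"
      and r: "reducing_on S M V1" "reducing_on S M V2" "reducing_on S M V3" for S M
  proof -
    have r': "reducing_on S M T" and n: "normal_on M T" if "(T, T') \<in> F" for T T'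
      using that r P by (auto simp: F_def P_unitary_on_def)
    have M: "csubspace M" using P by (simp add: P_unitary_on_def closed_csubspace_def)
    have "T ` M \<subseteq> M \<and> T' ` M \<subseteq> M \<and> (\<forall>x\<in>M. T (T' x) = T' (T x))" if T: "(T, T') \<in> F" for T T'
    proof -
      have 1: "T' ` M \<subseteq> M" by (rule reducing_on_adjoint_invariant[OF F(2)[OF T] r'[OF T] S(1) S(2)[OF T]])
      have 2: "T ` M \<subseteq> M" using r'[OF T] by (simp add: reducing_on_def)
      show ?thesis using normal_on_restrict_iff[OF F[OF T] M 2 1] n[OF T] 1 2 by blast
    qed
    then show ?thesis unfolding Hu_def by (rule subset_normal_part)
  qed
  \<comment> \<open>The extension of the whole triple also extends its restriction to the invariant
    subspace \<open>Hc\<close>.\<close>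
  have Hc_iso: "P_isometry_on TYPE('k) Hc V1 V2 V3"
    unfolding P_isometry_on_def
    using Hc Hc_inv(1)[OF V_F(1)] Hc_inv(1)[OF V_F(2)] Hc_inv(1)[OF V_F(3)] J U int
    by (intro conjI exI[of _ J] exI[of _ K] exI[of _ U1] exI[of _ U2] exI[of _ U3]) auto
  have disjoint: "x = 0" if "x \<in> Hu" "x \<in> Hc" for x
    using that by (auto simp: Hc_def orth_compl_def cinner_self_eq_0_iff)
  have Hc_pure: "pure_P_isometry_on TYPE('k) Hc V1 V2 V3"
    unfolding pure_P_isometry_on_def
  proof (intro conjI Hc_iso notI, elim exE conjE)
    fix M assume M: "M \<noteq> {0}" "P_unitary_on M V1 V2 V3"
      and r: "reducing_on Hc M V1" "reducing_on Hc M V2" "reducing_on Hc M V3"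
    have "M \<subseteq> Hu"
    proof (rule maximal[OF M(2) _ _ r])
      show "csubspace Hc" using Hc by (simp add: closed_csubspace_def)
    qed (rule Hc_inv(2))
    moreover have "M \<subseteq> Hc" "0 \<in> M"
      using r by (auto simp: reducing_on_def closed_csubspace_def csubspace_def)
    ultimately show False using disjoint M(1) by blast
  qed
  have red_u: "reducing_on UNIV Hu T" and red_c: "reducing_on UNIV Hc T" if "(T, T') \<in> F" for T T'
    using red[OF that] Hu Hc Hu_inv[OF that] Hc_inv[OF that] by auto
  have unique: "Hu' = Hu"
    if Hu': "closed_csubspace Hu'" "P_unitary_on Hu' V1 V2 V3"
      and r: "reducing_on UNIV Hu' V1" "reducing_on UNIV Hu' V2" "reducing_on UNIV Hu' V3"
      and pure: "pure_P_isometry_on TYPE('k) (orth_compl UNIV Hu') V1 V2 V3" for Hu'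
  proof
    show le: "Hu' \<subseteq> Hu" by (rule maximal[OF Hu'(2) csub_UNIV _ r]) simp
    define Hc' where "Hc' = orth_compl UNIV Hu'"
    \<comment> \<open>This is the part of \<open>Hu\<close> missed by the competitor. It reduces the
      triple on \<open>Hc'\<close> to a \<open>P\<close>-unitary, so purity of \<open>Hc'\<close>
      forces it to be zero.\<close>
    define M where "M = Hu \<inter> Hc'"
    have Hc': "closed_csubspace Hc'"
      unfolding Hc'_def by (rule closed_csubspace_orth_compl[OF closed_csubspace_UNIV])
    have M: "closed_csubspace M"
      using Hu Hc' by (auto simp: M_def closed_csubspace_def csubspace_def)
    have Hc'_inv: "T ` Hc' \<subseteq> Hc' \<and> T' ` Hc' \<subseteq> Hc'" if T: "(T, T') \<in> F" for T T'
    proof -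
      have rT: "reducing_on UNIV Hu' T" using T r by (auto simp: F_def)
      have "T' ` Hu' \<subseteq> Hu'" by (rule reducing_on_adjoint_invariant[OF F(2)[OF T] rT csub_UNIV]) simp
      then show ?thesis
        using adjoint_preserves_orth_compl[OF F(2)[OF T], of Hu'] rT
        by (simp add: Hc'_def reducing_on_def)
    qed
    have M_inv: "T ` M \<subseteq> M \<and> T' ` M \<subseteq> M" if T: "(T, T') \<in> F" for T T'
      using Hc'_inv[OF T] Hu_inv[OF T] unfolding M_def by blast
    have "P_unitary_on M V1 V2 V3" by (rule unit[OF M _ M_inv]) (auto simp: M_def)
    moreover have "reducing_on Hc' M T" if T: "(T, T') \<in> F" for T T'
      by (rule red[OF T M]) (use Hc'_inv[OF T] M_inv[OF T] in \<open>auto simp: M_def\<close>)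
    ultimately have "M = {0}" using pure V_F unfolding pure_P_isometry_on_def Hc'_def by blast
    show "Hu \<subseteq> Hu'"
    proof
      fix x assume x: "x \<in> Hu"
      obtain p where p: "p \<in> Hu'" "x - p \<in> Hc'"
        using orthogonal_projection_exists[OF Hu'(1)] unfolding Hc'_def by blast
      \<comment> \<open>The remainder stays in \<open>Hu\<close> because \<open>p\<close> lies in
        \<open>Hu'\<close>, already known to be inside \<open>Hu\<close>.\<close>
      have "x - p \<in> M"
        using x p le Hu by (auto simp: M_def closed_csubspace_def intro: csubspace_diff)
      then show "x \<in> Hu'" using p(1) \<open>M = {0}\<close> by simp
    qed
  qed
  show ?thesis
  proof (rule ex1I[of _ "(Hu, Hc)"])
    show "case (Hu, Hc) of (Hu, Hc) \<Rightarrow> closed_csubspace Hu \<and> closed_csubspace Hc \<and>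
            Hc = orth_compl UNIV Hu \<and>
            reducing_on UNIV Hu V1 \<and> reducing_on UNIV Hu V2 \<and> reducing_on UNIV Hu V3 \<and>
            reducing_on UNIV Hc V1 \<and> reducing_on UNIV Hc V2 \<and> reducing_on UNIV Hc V3 \<and>
            P_unitary_on Hu V1 V2 V3 \<and>
            pure_P_isometry_on TYPE('k) Hc V1 V2 V3"
      using Hu Hc red_u red_c V_F Hc_pure unit[OF Hu subset_refl] Hu_inv Hc_def by blast
  next
    fix p assume p: "case p of (Hu, Hc) \<Rightarrow> closed_csubspace Hu \<and> closed_csubspace Hc \<and>
            Hc = orth_compl UNIV Hu \<and>
            reducing_on UNIV Hu V1 \<and> reducing_on UNIV Hu V2 \<and> reducing_on UNIV Hu V3 \<and>
            reducing_on UNIV Hc V1 \<and> reducing_on UNIV Hc V2 \<and> reducing_on UNIV Hc V3 \<and>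
            P_unitary_on Hu V1 V2 V3 \<and>
            pure_P_isometry_on TYPE('k) Hc V1 V2 V3"
    obtain A B where AB: "p = (A, B)" by (cases p)
    \<comment> \<open>Only the first component needs an argument, since the second is its orthogonal
      complement.\<close>
    have "A = Hu" using p AB by (intro unique) auto
    then show "p = (Hu, Hc)" using p AB by (simp add: Hc_def)
  qed
qed

end
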